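(* (Mr. Gerber's Lemma) Let $\delta\in[0,1]$, let $0\le q\le \tfrac12$, let $X\in\{0,1\}$ with $\Pr(X=1)=q$, and let $Y$ be the output of the binary symmetric channel with crossover probability $\delta$ and input $X$. Let $U_{\mathbf T}(q,x)$ be the maximum of $H(Y|W)$ over all discrete random variables $W$ satisfying $W\to X\to Y$ and $H(X|W)=x$. Then $U_{\mathbf T}(q,\cdot)$ is given parametrically as follows: for every $\alpha\in[0,1]$, putting $z=\max(\alpha,2q)$ and $x=\alpha\, h_b\!\left(\frac{q}{z}\right)$, we have $$U_{\mathbf T}(q,x)=\alpha\, h_b\!\left(\delta\star\frac{q}{z}\right)+(1-\alpha)\,h_b(\delta).$$ (When $\alpha=0$ the terms multiplied by $\alpha$ are read as $0$.)
   Context: For $p\in[0,1]$, $h_b(p)=-p\log p-(1-p)\log(1-p)$ is the binary entropy function, with $0\log 0=0$ (logarithm in base 2). For $a,b\in[0,1]$, $a\star b=(1-a)b+(1-b)a$. The binary symmetric channel with crossover probability $\delta$ has $P_{Y|X}(1|0)=P_{Y|X}(0|1)=\delta$. $W\to X\to Y$ means that $W$ and $Y$ are conditionally independent given $X$; the joint law of $(X,Y)$ is fixed and $W$ varies. Writing $\alpha_w=P_W(w)$ and $p_w=\Pr(X=1|W=w)$, one has $\sum_w\alpha_w p_w=q$, $H(X|W)=\sum_w\alpha_w h_b(p_w)$ and $H(Y|W)=\sum_w\alpha_w h_b(\delta\star p_w)$. *)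

theory Defs
  imports "HOL-Probability.Probability"
begin

(* log 2 0 = 0 in HOL, so the convention 0 log 0 = 0 needs no case distinction. *)
definition hb :: "real \<Rightarrow> real" where
  "hb p = - p * log 2 p - (1 - p) * log 2 (1 - p)"

definition bconv :: "real \<Rightarrow> real \<Rightarrow> real" (infixl \<open>\<star>\<close> 70) where
  "a \<star> b = (1 - a) * b + (1 - b) * a"

(* The binary alphabet is bool, with True for 1 and False for 0. *)
definition bsc :: "real \<Rightarrow> bool \<Rightarrow> bool pmf" where
  "bsc \<delta> x = bernoulli_pmf (if x then 1 - \<delta> else \<delta>)"

definition bsc_joint :: "real \<Rightarrow> real \<Rightarrow> (bool \<times> bool) pmf" where
  "bsc_joint \<delta> q =
     bind_pmf (bernoulli_pmf q) (\<lambda>x. bind_pmf (bsc \<delta> x) (\<lambda>y. return_pmf (x, y)))"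

(* H(A|B) in bits.  The simple-function notation of the library would require a
   finite range; with counting measures B may take infinitely many values. *)
definition cond_entropy ::
  "'o pmf \<Rightarrow> ('o \<Rightarrow> 'a::countable) \<Rightarrow> ('o \<Rightarrow> 'b::countable) \<Rightarrow> real" where
  "cond_entropy P A B =
     prob_space.conditional_entropy (measure_pmf P) 2
       (count_space UNIV) (count_space UNIV) A B"

(* Since division by zero yields 0, the equation is trivial for values x with Pr(X = x) = 0. *)
definition markov_chain ::
  "'o pmf \<Rightarrow> ('o \<Rightarrow> 'w) \<Rightarrow> ('o \<Rightarrow> 'x) \<Rightarrow> ('o \<Rightarrow> 'y) \<Rightarrow> bool" where
  "markov_chain P W X Y \<longleftrightarrow>
     (\<forall>w x y. \<P>(\<omega> in measure_pmf P. W \<omega> = w \<and> Y \<omega> = y \<bar> X \<omega> = x) =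
              \<P>(\<omega> in measure_pmf P. W \<omega> = w \<bar> X \<omega> = x) *
              \<P>(\<omega> in measure_pmf P. Y \<omega> = y \<bar> X \<omega> = x))"

type_synonym joint_law = "(nat \<times> bool \<times> bool) pmf"

abbreviation W_rv :: "nat \<times> bool \<times> bool \<Rightarrow> nat" where "W_rv \<equiv> fst"
abbreviation X_rv :: "nat \<times> bool \<times> bool \<Rightarrow> bool" where "X_rv \<equiv> (\<lambda>\<omega>. fst (snd \<omega>))"
abbreviation Y_rv :: "nat \<times> bool \<times> bool \<Rightarrow> bool" where "Y_rv \<equiv> (\<lambda>\<omega>. snd (snd \<omega>))"

(* All joint laws of (W, X, Y) with W discrete, W -> X -> Y, and the prescribed law of
   (X, Y).  A discrete W has countably many values, so they may be labelled by
   natural numbers; finite and countably infinite supports are both included. *)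
definition aux_laws :: "real \<Rightarrow> real \<Rightarrow> joint_law set" where
  "aux_laws \<delta> q =
     {P. map_pmf (\<lambda>\<omega>. (X_rv \<omega>, Y_rv \<omega>)) P = bsc_joint \<delta> q \<and> markov_chain P W_rv X_rv Y_rv}"

definition feasible_laws :: "real \<Rightarrow> real \<Rightarrow> real \<Rightarrow> joint_law set" where
  "feasible_laws \<delta> q x = {P \<in> aux_laws \<delta> q. cond_entropy P X_rv W_rv = x}"

definition is_maximum :: "real set \<Rightarrow> real \<Rightarrow> bool" where
  "is_maximum S m \<longleftrightarrow> m \<in> S \<and> (\<forall>s\<in>S. s \<le> m)"

(* The maximum of the conditional entropies H(Y|W); unspecified if none exists. *)
definition U_T :: "real \<Rightarrow> real \<Rightarrow> real \<Rightarrow> real" where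
  "U_T \<delta> q x = (THE m. is_maximum ((\<lambda>P. cond_entropy P Y_rv W_rv) ` feasible_laws \<delta> q x) m)"

end

theory Submission
  imports Defs "HOL-Real_Asymp.Real_Asymp"
begin

text \<open>
  Write p_W for the conditional probability that X = 1 given W.  If there are s and l such that
  hb (\<delta> \<star> p) \<le> hb \<delta> + s * p + l * hb p on [0, 1], then taking expectations gives
  H(Y|W) \<le> hb \<delta> + s * q + l * x.  For r = q / z such a pair exists with
  equality at p = 0 and p = r, and with s = 0 (hence equality at p = 1 as well) when r = 1/2.
  So the bound is attained when p_W takes the value r with probability \<alpha>, the value 1 with
  probability q - \<alpha> * r, and the value 0 otherwise.  That every feasible x lies on the
  parametrised curve follows from 0 \<le> x \<le> hb q and the intermediate value theorem.
\<close>

section \<open>Binary entropy\<close>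

text \<open>At 0 continuity is the limit from the right, which agrees with the convention 0 log 0 =
  0; hence \<open>hb\<close> is continuous up to both endpoints.\<close>

lemma continuous_on_mult_log: "continuous_on {0..} (\<lambda>x::real. x * log 2 x)"
  unfolding continuous_on_eq_continuous_within
proof
  fix x :: real assume "x \<in> {0..}"
  show "continuous (at x within {0..}) (\<lambda>x. x * log 2 x)"
  proof (cases "x = 0")
    case True
    have "((\<lambda>x::real. x * log 2 x) \<longlongrightarrow> 0) (at_right 0)" by real_asymp
    moreover have "at (0::real) within {0..} = at_right 0" by (simp add: at_within_Ici_at_right)
    ultimately show ?thesis using True by (simp add: continuous_within)
  next
    case False
    with \<open>x \<in> {0..}\<close> show ?thesis by (intro continuous_intros) auto
  qed
qed

lemma continuous_on_hb: "continuous_on {0..1} hb"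
proof -
  have "continuous_on {0..1} (\<lambda>p. - (p * log 2 p) - (1 - p) * log 2 (1 - p))"
    by (intro continuous_intros continuous_on_subset[OF continuous_on_mult_log]
        continuous_on_compose2[OF continuous_on_mult_log]) auto
  then show ?thesis by (simp add: hb_def[abs_def])
qed

lemma hb_symmetric: "hb (1 - p) = hb p"
  by (simp add: hb_def algebra_simps)

lemma hb_0 [simp]: "hb 0 = 0" and hb_1 [simp]: "hb 1 = 0" and hb_half [simp]: "hb (1 / 2) = 1"
  by (simp_all add: hb_def log_divide)

lemma hb_nonneg: assumes "0 \<le> p" "p \<le> 1" shows "0 \<le> hb p"
proof -
  have "0 \<le> - (t * log 2 t)" if "0 \<le> t" "t \<le> 1" for t :: real
    using that by (cases "t = 0") (auto simp: mult_nonneg_nonpos)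
  from this[of p] this[of "1 - p"] assms show ?thesis by (simp add: hb_def)
qed

text \<open>Gibbs' inequality for two Bernoulli laws. The right side is affine in \<open>p\<close>,
  the tangent of \<open>hb\<close> at \<open>q\<close>, so that averaging it yields Jensen's
  inequality.\<close>

lemma hb_le_cross_entropy:
  assumes p: "0 \<le> p" "p \<le> 1" and q: "0 < q" "q < 1"
  shows "hb p \<le> - p * log 2 q - (1 - p) * log 2 (1 - q)"
proof -
  have gibbs: "t * log 2 u - t * log 2 t \<le> (u - t) / ln 2" if "0 \<le> t" "0 < u" for t u :: real
  proof (cases "t = 0")
    case False
    with that have t: "0 < t" by simp
    have "ln (u / t) \<le> u / t - 1" using t that by (intro ln_le_minus_one) auto
    then have "t * ln (u / t) \<le> t * (u / t - 1)" using t by (intro mult_left_mono) auto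
    then have "t * (ln u - ln t) \<le> u - t" using t that by (simp add: ln_div algebra_simps)
    then have "t * (ln u - ln t) / ln 2 \<le> (u - t) / ln 2" by (simp add: divide_right_mono)
    then show ?thesis by (simp add: log_def diff_divide_distrib algebra_simps)
  qed (use that in simp)
  have "p * log 2 q - p * log 2 p + ((1 - p) * log 2 (1 - q) - (1 - p) * log 2 (1 - p))
      \<le> (q - p) / ln 2 + ((1 - q) - (1 - p)) / ln 2"
    using p q by (intro add_mono gibbs) auto
  also have "\<dots> = 0" by (simp flip: add_divide_distrib)
  finally show ?thesis by (simp add: hb_def)
qed

lemma hb_le_1: assumes "0 \<le> p" "p \<le> 1" shows "hb p \<le> 1"
  using hb_le_cross_entropy[OF assms, of "1 / 2"] by (simp add: log_divide)

text \<open>The derivative of \<open>hb\<close>, hence the negative of the usual log-odds.\<close>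

definition logit2 :: "real \<Rightarrow> real" where
  "logit2 p = log 2 (1 - p) - log 2 p"

lemma DERIV_hb:
  assumes "0 < p" "p < 1" shows "(hb has_real_derivative logit2 p) (at p)"
proof -
  have "((\<lambda>p. - (p * ln p) - (1 - p) * ln (1 - p)) has_real_derivative ln (1 - p) - ln p) (at p)"
    using assms by (auto intro!: derivative_eq_intros)
  then have "((\<lambda>p. (- (p * ln p) - (1 - p) * ln (1 - p)) / ln 2) has_real_derivative (ln (1 - p) - ln p) / ln 2) (at p)"
    by (rule DERIV_cdivide)
  then show ?thesis
    by (simp add: hb_def[abs_def] logit2_def log_def diff_divide_distrib)
qed

lemma DERIV_logit2:
  assumes "0 < p" "p < 1" shows "(logit2 has_real_derivative - 1 / (ln 2 * (p * (1 - p)))) (at p)"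
  unfolding logit2_def[abs_def]
  using assms by (auto intro!: derivative_eq_intros simp: field_simps)

section \<open>Convolution with a crossover probability\<close>

lemma bconv_bounds:
  assumes "0 \<le> d" "d \<le> 1" "0 \<le> p" "p \<le> 1" shows "0 \<le> d \<star> p" "d \<star> p \<le> 1"
proof -
  show "0 \<le> d \<star> p" using assms by (simp add: bconv_def)
  have "1 - d \<star> p = (1 - d) * (1 - p) + d * p" by (simp add: bconv_def algebra_simps)
  also have "\<dots> \<ge> 0" using assms by (intro add_nonneg_nonneg mult_nonneg_nonneg) auto
  finally show "d \<star> p \<le> 1" by simp
qed

text \<open>Both \<open>d \<star> p\<close> and its complement are convex combinations of
  \<open>d\<close> and \<open>1 - d\<close>, hence at least the smaller of these. So
  \<open>hb\<close> is differentiable at \<open>d \<star> p\<close> even for \<open>p\<close> equal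
  to 0 or 1.\<close>

lemma bconv_strict_bounds:
  assumes "0 < d" "d < 1" "0 \<le> p" "p \<le> 1" shows "0 < d \<star> p" "d \<star> p < 1"
proof -
  define m where "m = min d (1 - d)"
  have m: "0 < m" "m \<le> d" "m \<le> 1 - d" using assms by (simp_all add: m_def)
  have "m \<le> (1 - p) * d + p * (1 - d)" "m \<le> (1 - p) * (1 - d) + p * d"
    using add_mono[OF mult_left_mono[of m d "1 - p"] mult_left_mono[of m "1 - d" p]]
      add_mono[OF mult_left_mono[of m "1 - d" "1 - p"] mult_left_mono[of m d p]] assms m
    by (simp_all add: left_diff_distrib)
  moreover have "d \<star> p = (1 - p) * d + p * (1 - d)" "1 - d \<star> p = (1 - p) * (1 - d) + p * d"
    by (simp_all add: bconv_def algebra_simps)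
  ultimately show "0 < d \<star> p" "d \<star> p < 1" using m by linarith+
qed

lemma bconv_0: "\<delta> \<star> 0 = \<delta>" and bconv_1: "\<delta> \<star> 1 = 1 - \<delta>"
  by (simp_all add: bconv_def)

lemma bconv_half: "d \<star> (1 / 2) = 1 / 2"
  by (simp add: bconv_def field_simps)

text \<open>The law of total variance for the channel output: noise variance plus scaled input
  variance. It makes the second derivative of \<open>F\<close> below have a numerator affine in
  \<open>p * (1 - p)\<close>.\<close>

lemma bconv_variance: "(d \<star> p) * (1 - d \<star> p) = d * (1 - d) + (1 - 2 * d)\<^sup>2 * (p * (1 - p))"
  by (simp add: bconv_def power2_eq_square algebra_simps)

text \<open>The difference F of the two sides has F 0 = 0 and a double zero at r, so by Rolle F'' vanishes at
  some e < r.  Since F'' has the sign of N, which is monotone in p * (1 - p), F is concave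
  on [0, e] and convex on [e, 1/2], hence nonnegative on [0, 1/2].  On the other half,
  F p = F (1 - p) + s * (2 * p - 1), and s = F' (1/2) is nonnegative.\<close>
lemma hb_bconv_tangent_interior:
  fixes d r :: real
  assumes d: "0 < d" "d < 1" and r: "0 < r" "r \<le> 1 / 2"
  obtains s l where "\<And>p. 0 \<le> p \<Longrightarrow> p \<le> 1 \<Longrightarrow> hb (d \<star> p) \<le> hb d + s * p + l * hb p"
    and "hb (d \<star> r) = hb d + s * r + l * hb r" and "r = 1 / 2 \<Longrightarrow> s = 0"
proof -
  define g where "g p = hb (d \<star> p) - hb d" for p
  define g' where "g' p = (1 - 2 * d) * logit2 (d \<star> p)" for p
  \<comment> \<open>s and l solve F r = 0 and F' r = 0.\<close>
  define l where "l = (r * g' r - g r) / log 2 (1 - r)"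
  define s where "s = g' r - l * logit2 r"
  define F where "F p = s * p + l * hb p - g p" for p
  define F' where "F' p = s + l * logit2 p - g' p" for p
  \<comment> \<open>The second derivative of \<open>F\<close> will be \<open>N p / M p\<close>, with
    \<open>M p\<close> positive for \<open>p\<close> strictly between 0 and 1.\<close>
  define N where "N p = (1 - l) * (1 - 2 * d)\<^sup>2 * (p * (1 - p)) - l * (d * (1 - d))" for p
  define M where "M p = ln 2 * (p * (1 - p)) * ((d \<star> p) * (1 - d \<star> p))" for p

  have s_half: "s = 0" if "r = 1 / 2"
    unfolding s_def g'_def that by (simp add: logit2_def bconv_half)
  have log_r: "log 2 (1 - r) < 0" using r by (simp add: log_less_zero_cancel_iff)
  \<comment> \<open>The left side is the determinant of the linear system for \<open>s\<close> and
    \<open>l\<close>, nonzero by \<open>log_r\<close>.\<close>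
  have "r * logit2 r - hb r = log 2 (1 - r)"
    by (simp add: hb_def logit2_def algebra_simps)
  then have "l * (r * logit2 r - hb r) = r * g' r - g r"
    using log_r by (simp add: l_def)
  then have Fr: "F r = 0" by (simp add: F_def s_def algebra_simps)
  have F'r: "F' r = 0" by (simp add: F'_def s_def)
  have F0: "F 0 = 0" by (simp add: F_def g_def bconv_def)
  have F'half: "F' (1 / 2) = s"
    by (simp add: F'_def g'_def logit2_def bconv_half)

  have bconv_deriv: "((\<lambda>p. d \<star> p) has_real_derivative 1 - 2 * d) (at p)" for p
    unfolding bconv_def by (auto intro!: derivative_eq_intros)
  have F_deriv: "(F has_real_derivative F' p) (at p)" if "0 < p" "p < 1" for p
    unfolding F_def[abs_def] F'_def g_def g'_def
    using that d bconv_strict_bounds[of d p]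
    by (auto intro!: derivative_eq_intros DERIV_hb DERIV_chain2[OF DERIV_hb bconv_deriv])
  have F'_deriv: "(F' has_real_derivative N p / M p) (at p)" and M_pos: "0 < M p" if "0 < p" "p < 1" for p
  proof -
    define v where "v = p * (1 - p)"
    define u where "u = (d \<star> p) * (1 - d \<star> p)"
    have pos: "0 < v" "0 < u" using that d bconv_strict_bounds[of d p] by (simp_all add: u_def v_def)
    then show "0 < M p" by (simp add: M_def u_def v_def)
    have "(F' has_real_derivative l * (- 1 / (ln 2 * v)) - (1 - 2 * d) * (- 1 / (ln 2 * u) * (1 - 2 * d))) (at p)"
      unfolding F'_def[abs_def] g'_def u_def v_def
      using that d bconv_strict_bounds[of d p]
      by (auto intro!: derivative_eq_intros DERIV_logit2 DERIV_chain2[OF DERIV_logit2 bconv_deriv])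
    also have "l * (- 1 / (ln 2 * v)) - (1 - 2 * d) * (- 1 / (ln 2 * u) * (1 - 2 * d)) =
        ((1 - 2 * d)\<^sup>2 * v - l * u) / (ln 2 * v * u)"
      using pos by (simp add: field_simps power2_eq_square)
    also have "(1 - 2 * d)\<^sup>2 * v - l * u = N p"
      by (simp add: N_def u_def v_def bconv_variance) (simp add: algebra_simps)
    finally show "(F' has_real_derivative N p / M p) (at p)" by (simp add: M_def u_def v_def)
  qed
  have F_cont: "continuous_on {0..1} F"
    unfolding F_def[abs_def] g_def
    using d by (intro continuous_intros continuous_on_hb continuous_on_compose2[OF continuous_on_hb])
      (auto simp: bconv_bounds, auto simp: bconv_def intro!: continuous_intros)
  \<comment> \<open>The left end \<open>a = 0\<close> is allowed, where only the continuity of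
    \<open>F\<close> is available.\<close>
  have F_mvt: "\<exists>z>a. z < b \<and> F b - F a = (b - a) * F' z" if "0 \<le> a" "a < b" "b < 1" for a b
  proof -
    have "\<exists>c z. a < z \<and> z < b \<and> (F has_real_derivative c) (at z) \<and> F b - F a = (b - a) * c"
      using that by (intro MVT continuous_on_subset[OF F_cont])
        (auto simp: real_differentiable_def intro!: exI F_deriv)
    then obtain c z where z: "a < z" "z < b" "(F has_real_derivative c) (at z)" "F b - F a = (b - a) * c"
      by blast
    then have "c = F' z" using F_deriv[of z] that by (intro DERIV_unique) auto
    with z show ?thesis by auto
  qed

  obtain c where c: "0 < c" "c < r" "F' c = 0"
    using F_mvt[of 0 r] r Fr F0 by auto
  have "\<exists>z>c. z < r \<and> F' r - F' c = (r - c) * (N z / M z)"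
    using c r by (intro MVT2 F'_deriv) auto
  then obtain e where e: "c < e" "e < r" "N e = 0"
    using c F'r M_pos r by (auto simp: less_le)
  have e0: "0 < e" using c e by simp
  \<comment> \<open>For \<open>l > 1\<close> the first term of \<open>N e\<close> is at most 0 and
    the subtracted one is positive, against \<open>N e = 0\<close>.\<close>
  have l1: "l \<le> 1"
  proof (rule ccontr)
    assume "\<not> l \<le> 1"
    then have "(1 - l) * ((1 - 2 * d)\<^sup>2 * (e * (1 - e))) \<le> 0" and "0 < l * (d * (1 - d))"
      using e0 e r d by (auto intro!: mult_nonpos_nonneg mult_nonneg_nonneg)
    with e show False by (simp add: N_def mult.assoc)
  qed
  \<comment> \<open>Subtracting \<open>N e = 0\<close> leaves a multiple of
    \<open>p * (1 - p) - e * (1 - e)\<close>, which factors; \<open>1 - p - e\<close> is positive on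
    [0, 1/2], so \<open>p - e\<close> decides the sign.\<close>
  have N_eq: "N p = (1 - l) * (1 - 2 * d)\<^sup>2 * (1 - p - e) * (p - e)" for p
  proof -
    have "N p = N p - N e" using e by simp
    then show ?thesis by (simp add: N_def algebra_simps)
  qed
  have N_nonneg: "0 \<le> N p" if "e \<le> p" "p \<le> 1 / 2" for p
    unfolding N_eq using that l1 e r by (intro mult_nonneg_nonneg) auto
  have N_nonpos: "N p \<le> 0" if "p \<le> e" for p
    unfolding N_eq using that l1 e r by (intro mult_nonneg_nonpos mult_nonneg_nonneg) auto
  have F'_mono: "F' a \<le> F' b" if "e \<le> a" "a \<le> b" "b \<le> 1 / 2" for a b
    using that(2)
    by (rule DERIV_nonneg_imp_nondecreasing)
      (use that e0 in \<open>auto intro!: exI[of _ "N _ / M _"] F'_deriv divide_nonneg_pos N_nonneg M_pos\<close>)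
  have F'_antimono: "F' b \<le> F' a" if "0 < a" "a \<le> b" "b \<le> e" for a b
    using that(2)
    by (rule DERIV_nonpos_imp_nonincreasing)
      (use that e r in \<open>auto intro!: exI[of _ "N _ / M _"] F'_deriv divide_nonpos_pos N_nonpos M_pos\<close>)
  \<comment> \<open>On [e, 1/2] the derivative is nondecreasing and vanishes at \<open>r\<close>, so
    \<open>F\<close> is minimal there.\<close>
  have F_middle: "0 \<le> F p" if "e \<le> p" "p \<le> 1 / 2" for p
  proof (cases "p \<le> r")
    case True
    then have "F r \<le> F p"
    proof (rule DERIV_nonpos_imp_nonincreasing)
      fix x assume "p \<le> x" "x \<le> r"
      then show "\<exists>y. (F has_real_derivative y) (at x) \<and> y \<le> 0"
        using F_deriv[of x] F'_mono[of x r] F'r e0 that r by auto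
    qed
    then show ?thesis by (simp add: Fr)
  next
    case False
    then have "r \<le> p" by simp
    then have "F r \<le> F p"
    proof (rule DERIV_nonneg_imp_nondecreasing)
      fix x assume "r \<le> x" "x \<le> p"
      then show "\<exists>y. (F has_real_derivative y) (at x) \<and> 0 \<le> y"
        using F_deriv[of x] F'_mono[of r x] F'r e that r by auto
    qed
    then show ?thesis by (simp add: Fr)
  qed
  \<comment> \<open>A negative value at \<open>p < e\<close> would force a negative slope at some
    \<open>u < p\<close> and a positive one at some \<open>v > p\<close>, while \<open>F'\<close> is
    nonincreasing up to \<open>e\<close>.\<close>
  have F_left: "0 \<le> F p" if "0 \<le> p" "p \<le> 1 / 2" for p
  proof (rule ccontr)
    assume neg: "\<not> 0 \<le> F p"
    then have p: "0 < p" "p < e" using F_middle[of p] F0 that by (auto simp: less_le)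
    obtain u where u: "0 < u" "u < p" "F p - F 0 = (p - 0) * F' u"
      using F_mvt[of 0 p] p e r by auto
    obtain v where v: "p < v" "v < e" "F e - F p = (e - p) * F' v"
      using F_mvt[of p e] p e r by auto
    have "F' u < 0" using u p neg F0 by (simp add: mult_less_0_iff not_le)
    moreover have "0 < (e - p) * F' v" using v neg F_middle[of e] e r by simp
    then have "0 < F' v" using p by (simp add: zero_less_mult_iff)
    moreover have "F' v \<le> F' u" using u v by (intro F'_antimono) auto
    ultimately show False by simp
  qed
  have s0: "0 \<le> s" using F'_mono[of r "1 / 2"] F'r F'half e r by simp
  have F_nonneg: "0 \<le> F p" if "0 \<le> p" "p \<le> 1" for p
  proof (cases "p \<le> 1 / 2")
    case False
    have "d \<star> (1 - p) = 1 - d \<star> p" by (simp add: bconv_def algebra_simps)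
    then have "hb (d \<star> (1 - p)) = hb (d \<star> p)" by (simp only: hb_symmetric)
    then have "F p = F (1 - p) + s * (2 * p - 1)"
      by (simp add: F_def g_def hb_symmetric algebra_simps)
    then show ?thesis using F_left[of "1 - p"] s0 False that by simp
  qed (use F_left that in auto)
  show ?thesis
  proof (rule that[of s l])
    show "hb (d \<star> p) \<le> hb d + s * p + l * hb p" if "0 \<le> p" "p \<le> 1" for p
      using F_nonneg[OF that] by (simp add: F_def g_def)
    show "hb (d \<star> r) = hb d + s * r + l * hb r" using Fr by (simp add: F_def g_def)
  qed (rule s_half)
qed

text \<open>For \<open>d\<close> equal to 0 or 1 the channel is invertible and preserves the
  entropy, so \<open>s = 0\<close> and \<open>l = 1\<close> serve.\<close>

lemma hb_bconv_tangent:
  fixes d r :: real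
  assumes d: "0 \<le> d" "d \<le> 1" and r: "0 < r" "r \<le> 1 / 2"
  obtains s l where "\<And>p. 0 \<le> p \<Longrightarrow> p \<le> 1 \<Longrightarrow> hb (d \<star> p) \<le> hb d + s * p + l * hb p"
    and "hb (d \<star> r) = hb d + s * r + l * hb r" and "r = 1 / 2 \<Longrightarrow> s = 0"
proof (cases "d = 0 \<or> d = 1")
  case True
  then have "hb (d \<star> p) = hb d + 0 * p + 1 * hb p" for p
    by (auto simp: bconv_def hb_symmetric)
  then show ?thesis by (intro that[of 0 1]) simp_all
next
  case False
  then show ?thesis using d r hb_bconv_tangent_interior[of d r] that by (metis less_le)
qed

section \<open>Conditional entropy of a binary variable\<close>

text \<open>A crude constant from \<open>ln u \<le> u - 1\<close> suffices: it only has to dominate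
  the entropy integrand when the conditioning variable takes infinitely many values.\<close>

lemma abs_mult_log_le:
  fixes t :: real assumes "0 \<le> t" "t \<le> 1" shows "\<bar>t * log 2 t\<bar> \<le> 1 / ln 2"
proof (cases "t = 0")
  case False
  with assms have t: "0 < t" by simp
  have "ln (1 / t) \<le> 1 / t - 1" using t by (intro ln_le_minus_one) auto
  then have "t * - ln t \<le> t * (1 / t - 1)" using t by (intro mult_left_mono) (auto simp: ln_div)
  also have "\<dots> \<le> 1" using t by (simp add: algebra_simps)
  finally have "- (t * ln t) \<le> 1" by simp
  moreover have "ln t \<le> 0" using t assms by simp
  then have "t * ln t \<le> 0" using t by (simp add: mult_nonneg_nonpos)
  ultimately have "\<bar>t * ln t\<bar> \<le> 1" by linarith
  moreover have "\<bar>t * log 2 t\<bar> = \<bar>t * ln t\<bar> / ln 2"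
    by (simp add: log_def abs_mult)
  ultimately show ?thesis by (simp add: divide_right_mono)
qed simp

lemma distributed_pmf:
  fixes f :: "'o \<Rightarrow> 'a::countable"
  shows "distributed (measure_pmf P) (count_space UNIV) f (pmf (map_pmf f P))"
  unfolding distributed_def
  using measure_pmf_eq_density[of "map_pmf f P"] by (simp add: map_pmf_rep_eq)

lemma pmf_marginal_bool:
  fixes A :: "'o \<Rightarrow> bool"
  shows "pmf (map_pmf B P) w =
    pmf (map_pmf (\<lambda>\<omega>. (A \<omega>, B \<omega>)) P) (True, w) + pmf (map_pmf (\<lambda>\<omega>. (A \<omega>, B \<omega>)) P) (False, w)"
proof -
  define J where "J = map_pmf (\<lambda>\<omega>. (A \<omega>, B \<omega>)) P"
  have "map_pmf B P = map_pmf snd J" by (simp add: J_def map_pmf_comp)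
  moreover have "snd -` {w} = {(True, w), (False, w)}" by (auto simp: vimage_def)
  ultimately have "pmf (map_pmf B P) w = measure J {(True, w), (False, w)}"
    by (simp add: pmf_map[of snd])
  then show ?thesis by (simp add: measure_measure_pmf_finite flip: J_def)
qed

text \<open>Fubini on the product of counting measures reduces the general formula to a sum over the
  two values of \<open>A\<close>, which combine to \<open>- hb\<close> of the conditional
  probability. A multiple of the summable mass function of \<open>B\<close> dominates the
  integrand.\<close>

lemma cond_entropy_bool:
  fixes A :: "'o \<Rightarrow> bool" and B :: "'o \<Rightarrow> 'b::countable"
  shows "cond_entropy P A B =
    (\<integral>w. hb (pmf (map_pmf (\<lambda>\<omega>. (A \<omega>, B \<omega>)) P) (True, w) / pmf (map_pmf B P) w) \<partial>map_pmf B P)"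
proof -
  define J where "J = map_pmf (\<lambda>\<omega>. (A \<omega>, B \<omega>)) P"
  define N where "N = map_pmf B P"
  define f where "f = (\<lambda>z. pmf J z * log 2 (pmf J z / pmf N (snd z)))"
  let ?S = "count_space UNIV :: bool measure" and ?T = "count_space UNIV :: 'b measure"
  interpret information_space "measure_pmf P" 2
    by unfold_locales auto
  interpret ST: pair_sigma_finite ?S ?T
    by (simp add: pair_sigma_finite_def sigma_finite_measure_count_space_countable)
  have ST: "?S \<Otimes>\<^sub>M ?T = count_space UNIV"
    by (subst pair_measure_countable) auto
  have N_sum: "pmf N w = pmf J (True, w) + pmf J (False, w)" for w
    unfolding N_def J_def by (rule pmf_marginal_bool)
  have J_le: "pmf J (b, w) \<le> pmf N w" for b w
    using N_sum[of w] by (cases b) auto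
  have f_bound: "\<bar>f (b, w)\<bar> \<le> pmf N w * (1 / ln 2)" for b w
  proof (cases "pmf N w = 0")
    case True
    then have "pmf J (b, w) = 0" using J_le[of b w] by (simp add: order.antisym)
    then show ?thesis by (simp add: f_def)
  next
    case False
    have "f (b, w) = pmf N w * (pmf J (b, w) / pmf N w * log 2 (pmf J (b, w) / pmf N w))"
      using False by (simp add: f_def)
    also have "\<bar>\<dots>\<bar> = pmf N w * \<bar>pmf J (b, w) / pmf N w * log 2 (pmf J (b, w) / pmf N w)\<bar>"
      by (simp add: abs_mult)
    also have "\<dots> \<le> pmf N w * (1 / ln 2)"
      using J_le[of b w] False by (intro mult_left_mono abs_mult_log_le) (auto simp: divide_le_eq_1)
    finally show ?thesis .
  qed
  have f_int: "integrable ?T (\<lambda>w. f (b, w))" for b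
    by (rule Bochner_Integration.integrable_bound[where f="\<lambda>w. pmf N w * (1 / ln 2)"])
       (use f_bound in \<open>auto intro!: integrable_pmf\<close>)
  have "integrable (?S \<Otimes>\<^sub>M ?T) f"
    by (rule ST.Fubini_integrable)
       (auto intro!: f_int integrable_count_space simp: ST)
  then have "(\<integral>z. f z \<partial>(?S \<Otimes>\<^sub>M ?T)) = (\<integral>b. (\<integral>w. f (b, w) \<partial>?T) \<partial>?S)"
    by (rule ST.integral_fst'[symmetric])
  also have "\<dots> = (\<integral>w. f (True, w) \<partial>?T) + (\<integral>w. f (False, w) \<partial>?T)"
    by (subst lebesgue_integral_count_space_finite) (auto simp: UNIV_bool)
  also have "\<dots> = (\<integral>w. f (True, w) + f (False, w) \<partial>?T)"
    by (simp add: f_int)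
  also have "\<dots> = (\<integral>w. pmf N w *\<^sub>R - hb (pmf J (True, w) / pmf N w) \<partial>?T)"
  proof (rule Bochner_Integration.integral_cong[OF refl])
    fix w
    show "f (True, w) + f (False, w) = pmf N w *\<^sub>R - hb (pmf J (True, w) / pmf N w)"
    proof (cases "pmf N w = 0")
      case True
      then have "pmf J (b, w) = 0" for b using J_le[of b w] by (simp add: order.antisym)
      then show ?thesis using True by (simp add: f_def)
    next
      case False
      have "1 - pmf J (True, w) / pmf N w = pmf J (False, w) / pmf N w"
        using False N_sum[of w] by (simp add: field_simps)
      then have hb: "hb (pmf J (True, w) / pmf N w) =
          - (pmf J (True, w) / pmf N w) * log 2 (pmf J (True, w) / pmf N w)
          - pmf J (False, w) / pmf N w * log 2 (pmf J (False, w) / pmf N w)"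
        by (simp only: hb_def)
      show ?thesis using False by (simp add: f_def hb algebra_simps)
    qed
  qed
  also have "\<dots> = - (\<integral>w. hb (pmf J (True, w) / pmf N w) \<partial>N)"
    by (simp add: measure_pmf_eq_density[of N] integral_density)
  finally have "(\<integral>z. f z \<partial>(?S \<Otimes>\<^sub>M ?T)) = - (\<integral>w. hb (pmf J (True, w) / pmf N w) \<partial>N)" .
  moreover have "cond_entropy P A B = - (\<integral>z. f z \<partial>(?S \<Otimes>\<^sub>M ?T))"
    unfolding cond_entropy_def
    by (subst conditional_entropy_generic_eq[where Pxy = "pmf J" and Py = "pmf N"])
       (auto simp: ST J_def N_def f_def distributed_pmf split_beta' sigma_finite_measure_count_space_countable)
  ultimately show ?thesis by (simp add: J_def N_def)
qed

section \<open>Joint laws of the Markov chain\<close>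

lemma pmf_bind_Pair:
  "pmf (bind_pmf Q (\<lambda>a. map_pmf (Pair a) (K a))) (a, b) = pmf Q a * pmf (K a) b"
proof -
  have "pmf (map_pmf (Pair a') (K a')) (a, b) = (if a' = a then pmf (K a) b else 0)" for a'
    using pmf_map_inj'[of "Pair a" "K a" b]
    by (auto intro!: pmf_map_outside inj_onI)
  then show ?thesis
    unfolding pmf_bind by (subst integral_measure_pmf_real[where A="{a}"]) (auto split: if_splits)
qed

lemma bsc_joint_eq:
  "bsc_joint \<delta> q = bind_pmf (bernoulli_pmf q) (\<lambda>x. map_pmf (Pair x) (bsc \<delta> x))"
  by (simp add: bsc_joint_def map_pmf_def)

lemma pmf_bsc_joint: "pmf (bsc_joint \<delta> q) (x, y) = pmf (bernoulli_pmf q) x * pmf (bsc \<delta> x) y"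
  by (simp add: bsc_joint_eq pmf_bind_Pair)

lemma map_fst_bsc_joint: "map_pmf fst (bsc_joint \<delta> q) = bernoulli_pmf q"
  by (simp add: bsc_joint_eq map_bind_pmf map_pmf_comp bind_return_pmf')

lemma map_X_aux_laws:
  assumes "P \<in> aux_laws \<delta> q" shows "map_pmf X_rv P = bernoulli_pmf q"
proof -
  have "map_pmf X_rv P = map_pmf fst (map_pmf (\<lambda>\<omega>. (X_rv \<omega>, Y_rv \<omega>)) P)"
    by (simp add: map_pmf_comp)
  with assms show ?thesis by (simp add: aux_laws_def map_fst_bsc_joint)
qed

lemma prob_eq_pmf_map: "\<P>(\<omega> in measure_pmf P. f \<omega> = a) = pmf (map_pmf f P) a"
  by (simp add: pmf_map vimage_def)

text \<open>The conditional probabilities are cleared of denominators, which is harmless also when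
  X takes the value x with probability 0, since then both sides vanish.\<close>
lemma markov_chain_iff:
  "markov_chain P W X Y \<longleftrightarrow>
     (\<forall>w x y. pmf (map_pmf (\<lambda>\<omega>. (W \<omega>, X \<omega>, Y \<omega>)) P) (w, x, y) * pmf (map_pmf X P) x =
       pmf (map_pmf (\<lambda>\<omega>. (X \<omega>, W \<omega>)) P) (x, w) * pmf (map_pmf (\<lambda>\<omega>. (X \<omega>, Y \<omega>)) P) (x, y))"
proof -
  have 1: "pmf (map_pmf (\<lambda>\<omega>. (W \<omega>, X \<omega>, Y \<omega>)) P) (w, x, y) = \<P>(\<omega> in measure_pmf P. (W \<omega> = w \<and> Y \<omega> = y) \<and> X \<omega> = x)"
    "pmf (map_pmf (\<lambda>\<omega>. (X \<omega>, W \<omega>)) P) (x, w) = \<P>(\<omega> in measure_pmf P. W \<omega> = w \<and> X \<omega> = x)"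
    "pmf (map_pmf (\<lambda>\<omega>. (X \<omega>, Y \<omega>)) P) (x, y) = \<P>(\<omega> in measure_pmf P. Y \<omega> = y \<and> X \<omega> = x)"
    "pmf (map_pmf X P) x = \<P>(\<omega> in measure_pmf P. X \<omega> = x)" for w x y
    by (auto simp: prob_eq_pmf_map[symmetric] intro!: arg_cong[where f="measure P"])
  have 2: "\<P>(\<omega> in measure_pmf P. W \<omega> = w \<and> X \<omega> = x) = 0" if "\<P>(\<omega> in measure_pmf P. X \<omega> = x) = 0" for w x
    using that by (auto simp: measure_pmf_zero_iff)
  have 3: "a / e = c / e * (b / e) \<longleftrightarrow> a * e = c * b" if "e = 0 \<Longrightarrow> c = 0" for a b c e :: real
    using that by (cases "e = 0") (auto simp: field_simps)
  show ?thesis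
    unfolding markov_chain_def cond_prob_def 1
    by (intro iff_allI 3 2)
qed

text \<open>A positive probability of \<open>X = x\<close> cancels from the Markov identity; if it
  is 0, the joint masses below it vanish too.\<close>

lemma pmf_aux_laws:
  assumes "P \<in> aux_laws \<delta> q"
  shows "pmf P (w, x, y) = pmf (map_pmf (\<lambda>\<omega>. (X_rv \<omega>, W_rv \<omega>)) P) (x, w) * pmf (bsc \<delta> x) y"
proof -
  let ?X = "pmf (map_pmf X_rv P) x" and ?XW = "pmf (map_pmf (\<lambda>\<omega>. (X_rv \<omega>, W_rv \<omega>)) P) (x, w)"
  have "pmf P (w, x, y) * ?X = ?XW * (?X * pmf (bsc \<delta> x) y)"
    using assms
    by (auto simp: aux_laws_def markov_chain_iff pmf_bsc_joint map_X_aux_laws[OF assms])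
  moreover have "pmf P (w, x, y) \<le> ?XW" "?XW \<le> ?X"
    by (simp_all add: pmf.rep_eq[of P] pmf_map measure_pmf.finite_measure_mono subset_eq)
  ultimately show ?thesis
    using pmf_nonneg[of P "(w, x, y)"] pmf_nonneg[of "map_pmf (\<lambda>\<omega>. (X_rv \<omega>, W_rv \<omega>)) P" "(x, w)"]
    by (cases "?X = 0") auto
qed

text \<open>Summing the factorised law over both inputs sends the posterior of \<open>X\<close>
  through the channel. At a \<open>w\<close> of mass 0 division by zero would give 0 on the left but
  \<open>\<delta>\<close> on the right.\<close>

lemma map_YW_aux_laws:
  assumes "P \<in> aux_laws \<delta> q" and \<delta>: "0 \<le> \<delta>" "\<delta> \<le> 1" and "pmf (map_pmf W_rv P) w \<noteq> 0"
  shows "pmf (map_pmf (\<lambda>\<omega>. (Y_rv \<omega>, W_rv \<omega>)) P) (True, w) / pmf (map_pmf W_rv P) w =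
    \<delta> \<star> (pmf (map_pmf (\<lambda>\<omega>. (X_rv \<omega>, W_rv \<omega>)) P) (True, w) / pmf (map_pmf W_rv P) w)"
proof -
  let ?XW = "\<lambda>x. pmf (map_pmf (\<lambda>\<omega>. (X_rv \<omega>, W_rv \<omega>)) P) (x, w)"
  have "(\<lambda>\<omega>. (Y_rv \<omega>, W_rv \<omega>)) -` {(True, w)} = {(w, True, True), (w, False, True)}" by auto
  then have "pmf (map_pmf (\<lambda>\<omega>. (Y_rv \<omega>, W_rv \<omega>)) P) (True, w) = pmf P (w, True, True) + pmf P (w, False, True)"
    by (simp add: pmf_map measure_measure_pmf_finite)
  also have "\<dots> = ?XW True * (1 - \<delta>) + ?XW False * \<delta>"
    using \<delta> by (simp add: pmf_aux_laws[OF assms(1)] bsc_def)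
  finally have Y: "pmf (map_pmf (\<lambda>\<omega>. (Y_rv \<omega>, W_rv \<omega>)) P) (True, w) = ?XW True * (1 - \<delta>) + ?XW False * \<delta>" .
  have "pmf (map_pmf W_rv P) w = ?XW True + ?XW False"
    by (rule pmf_marginal_bool)
  then have "?XW False / pmf (map_pmf W_rv P) w = 1 - ?XW True / pmf (map_pmf W_rv P) w"
    using assms(4) by (simp add: field_simps)
  then show ?thesis
    by (simp add: Y bconv_def add_divide_distrib mult.commute[of _ \<delta>] mult.commute[of _ "1 - \<delta>"]
        flip: times_divide_eq_right)
qed

text \<open>The converse construction, from a law of \<open>W\<close> and prescribed posteriors to a
  joint law. Drawing \<open>Y\<close> from \<open>X\<close> alone builds in the Markov property, and
  the nested pairs fit \<open>pmf_bind_Pair\<close>.\<close>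

definition aux_law :: "real \<Rightarrow> nat pmf \<Rightarrow> (nat \<Rightarrow> real) \<Rightarrow> joint_law" where
  "aux_law \<delta> Q p = bind_pmf Q (\<lambda>w. map_pmf (Pair w)
     (bind_pmf (bernoulli_pmf (p w)) (\<lambda>x. map_pmf (Pair x) (bsc \<delta> x))))"

lemma map_W_aux_law: "map_pmf W_rv (aux_law \<delta> Q p) = Q"
  by (simp add: aux_law_def map_bind_pmf map_pmf_comp bind_return_pmf')

lemma pmf_map_swap: "pmf (map_pmf (\<lambda>\<omega>. (f \<omega>, g \<omega>)) P) (a, b) = pmf (map_pmf (\<lambda>\<omega>. (g \<omega>, f \<omega>)) P) (b, a)"
  by (simp add: pmf_map vimage_def conj_commute)

lemma pmf_XW_aux_law:
  "pmf (map_pmf (\<lambda>\<omega>. (X_rv \<omega>, W_rv \<omega>)) (aux_law \<delta> Q p)) (x, w) = pmf Q w * pmf (bernoulli_pmf (p w)) x"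
proof -
  have "map_pmf (\<lambda>\<omega>. (W_rv \<omega>, X_rv \<omega>)) (aux_law \<delta> Q p) = bind_pmf Q (\<lambda>w. map_pmf (Pair w) (bernoulli_pmf (p w)))"
    by (simp add: aux_law_def map_bind_pmf map_pmf_comp) (simp add: map_pmf_def)
  then show ?thesis by (subst pmf_map_swap) (simp add: pmf_bind_Pair)
qed

text \<open>A mixture of Bernoulli laws is Bernoulli with the mean parameter, so \<open>mean\<close>
  fixes the law of \<open>X\<close>; the Markov identity then compares products of masses.\<close>

lemma aux_law_in_aux_laws:
  fixes Q :: "nat pmf"
  assumes p: "\<And>w. 0 \<le> p w" "\<And>w. p w \<le> 1" and mean: "(\<integral>w. p w \<partial>Q) = q"
  shows "aux_law \<delta> Q p \<in> aux_laws \<delta> q"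
proof -
  have q: "0 \<le> q" "q \<le> 1"
    using p mean by (auto intro!: integral_nonneg measure_pmf.integral_le_const measure_pmf.integrable_const_bound[where B=1])
  have "bind_pmf Q (\<lambda>w. bernoulli_pmf (p w)) = bernoulli_pmf q"
  proof (rule pmf_eqI)
    fix x
    have "integrable Q p"
      using p by (auto intro!: measure_pmf.integrable_const_bound[where B=1])
    then show "pmf (bind_pmf Q (\<lambda>w. bernoulli_pmf (p w))) x = pmf (bernoulli_pmf q) x"
      using p q mean by (cases x) (simp_all add: pmf_bind)
  qed
  then have "bind_pmf Q (\<lambda>w. bind_pmf (bernoulli_pmf (p w)) (\<lambda>x. map_pmf (Pair x) (bsc \<delta> x))) = bsc_joint \<delta> q"
    by (simp only: bsc_joint_eq flip: bind_assoc_pmf)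
  then have XY: "map_pmf (\<lambda>\<omega>. (X_rv \<omega>, Y_rv \<omega>)) (aux_law \<delta> Q p) = bsc_joint \<delta> q"
    by (simp add: aux_law_def map_bind_pmf map_pmf_comp)
  then have X: "map_pmf X_rv (aux_law \<delta> Q p) = bernoulli_pmf q"
    using map_fst_bsc_joint[of \<delta> q] by (simp add: XY[symmetric] map_pmf_comp)
  have "markov_chain (aux_law \<delta> Q p) W_rv X_rv Y_rv"
    unfolding markov_chain_iff XY X pmf_XW_aux_law pmf_bsc_joint
    by (simp add: aux_law_def pmf_bind_Pair)
  with XY show ?thesis by (simp add: aux_laws_def)
qed

section \<open>The extremal problem\<close>

text \<open>The law of total probability: the mass of \<open>w\<close> cancels the denominator, and
  where it is 0 the numerator is 0 as well.\<close>

lemma pmf_expectation_conditional: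
  fixes J :: "('a \<times> 'b::countable) pmf"
  shows "(\<integral>w. pmf J (a, w) / pmf (map_pmf snd J) w \<partial>map_pmf snd J) = pmf (map_pmf fst J) a"
proof -
  let ?N = "map_pmf snd J"
  have le: "pmf J (a, w) \<le> pmf ?N w" for w
    by (simp add: pmf.rep_eq[of J] pmf_map measure_pmf.finite_measure_mono subset_eq)
  have "(\<integral>w. pmf J (a, w) / pmf ?N w \<partial>?N) = (\<integral>w. pmf ?N w *\<^sub>R (pmf J (a, w) / pmf ?N w) \<partial>count_space UNIV)"
    by (simp add: measure_pmf_eq_density[of ?N] integral_density del: integral_map_pmf)
  also have "\<dots> = (\<integral>w. pmf J (a, w) \<partial>count_space UNIV)"
  proof (rule Bochner_Integration.integral_cong[OF refl])
    show "pmf ?N w *\<^sub>R (pmf J (a, w) / pmf ?N w) = pmf J (a, w)" for w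
      using le[of w] pmf_nonneg[of J "(a, w)"] by (cases "pmf ?N w = 0") auto
  qed
  also have "\<dots> = (\<integral>z. pmf J z \<partial>count_space (range (Pair a)))"
    by (rule integral_bij_count_space) (simp add: bij_betw_def inj_on_def)
  also have "\<dots> = measure J (range (Pair a))" by (rule integral_pmf)
  also have "range (Pair a) = fst -` {a}" by auto
  finally show ?thesis by (simp add: pmf_map)
qed

text \<open>The function written p_w in the informal text; its value is 0 when W = w has probability 0.\<close>
definition posterior :: "joint_law \<Rightarrow> nat \<Rightarrow> real" where
  "posterior P w = pmf (map_pmf (\<lambda>\<omega>. (X_rv \<omega>, W_rv \<omega>)) P) (True, w) / pmf (map_pmf W_rv P) w"

lemma posterior_bounds: "0 \<le> posterior P w" "posterior P w \<le> 1"
  using pmf_marginal_bool[of W_rv P w X_rv]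
  by (cases "pmf (map_pmf W_rv P) w = 0"; simp add: posterior_def divide_le_eq_1 order.strict_iff_order)+

lemma cond_entropy_X_W: "cond_entropy P X_rv W_rv = (\<integral>w. hb (posterior P w) \<partial>map_pmf W_rv P)"
  unfolding cond_entropy_bool posterior_def ..

lemma cond_entropy_Y_W:
  assumes "P \<in> aux_laws \<delta> q" "0 \<le> \<delta>" "\<delta> \<le> 1"
  shows "cond_entropy P Y_rv W_rv = (\<integral>w. hb (\<delta> \<star> posterior P w) \<partial>map_pmf W_rv P)"
  unfolding cond_entropy_bool posterior_def
  by (rule integral_cong_AE)
    (auto simp: AE_measure_pmf_iff set_pmf_iff[of _ "map_pmf W_rv P"] map_YW_aux_laws[OF assms] simp del: set_map_pmf)

lemma expectation_posterior:
  assumes "P \<in> aux_laws \<delta> q" "0 \<le> q" "q \<le> 1"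
  shows "(\<integral>w. posterior P w \<partial>map_pmf W_rv P) = q"
proof -
  have "map_pmf snd (map_pmf (\<lambda>\<omega>. (X_rv \<omega>, W_rv \<omega>)) P) = map_pmf W_rv P"
    "map_pmf fst (map_pmf (\<lambda>\<omega>. (X_rv \<omega>, W_rv \<omega>)) P) = map_pmf X_rv P"
    by (simp_all add: map_pmf_comp)
  with pmf_expectation_conditional[of "map_pmf (\<lambda>\<omega>. (X_rv \<omega>, W_rv \<omega>)) P" True] show ?thesis
    using assms by (simp only: map_X_aux_laws[OF assms(1)] posterior_def) simp
qed

section \<open>Bounds valid for every feasible law\<close>

lemma integrable_pmf_unit:
  fixes f :: "'a \<Rightarrow> real"
  assumes "\<And>w. 0 \<le> f w" "\<And>w. f w \<le> 1" shows "integrable (measure_pmf M) f"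
  using assms by (intro measure_pmf.integrable_const_bound[where B=1]) auto

lemma integrable_posterior:
  "integrable (map_pmf W_rv P) (posterior P)"
  "integrable (map_pmf W_rv P) (\<lambda>w. hb (posterior P w))"
  by (intro integrable_pmf_unit posterior_bounds hb_nonneg hb_le_1)+

text \<open>Weak duality: \<open>s\<close> and \<open>l\<close> are multipliers for the two
  constraints, the mean \<open>q\<close> of the posterior and the entropy \<open>x\<close>.\<close>

lemma cond_entropy_Y_W_le:
  assumes P: "P \<in> feasible_laws \<delta> q x" and \<delta>: "0 \<le> \<delta>" "\<delta> \<le> 1" and q: "0 \<le> q" "q \<le> 1"
    and tangent: "\<And>p. 0 \<le> p \<Longrightarrow> p \<le> 1 \<Longrightarrow> hb (\<delta> \<star> p) \<le> c + s * p + l * hb p"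
  shows "cond_entropy P Y_rv W_rv \<le> c + s * q + l * x"
proof -
  let ?N = "map_pmf W_rv P"
  have P': "P \<in> aux_laws \<delta> q" "x = (\<integral>w. hb (posterior P w) \<partial>?N)"
    using P by (auto simp: feasible_laws_def cond_entropy_X_W)
  note int = integrable_posterior[of P]
  have "cond_entropy P Y_rv W_rv = (\<integral>w. hb (\<delta> \<star> posterior P w) \<partial>?N)"
    by (rule cond_entropy_Y_W[OF P'(1) \<delta>])
  also have "\<dots> \<le> (\<integral>w. c + s * posterior P w + l * hb (posterior P w) \<partial>?N)"
    using \<delta> posterior_bounds[of P]
    by (intro integral_mono tangent integrable_pmf_unit[of "\<lambda>w. hb (\<delta> \<star> posterior P w)"]
        Bochner_Integration.integrable_add integrable_mult_right int measure_pmf.integrable_const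
        hb_nonneg hb_le_1 bconv_bounds)
  also have "\<dots> = c + s * (\<integral>w. posterior P w \<partial>?N) + l * (\<integral>w. hb (posterior P w) \<partial>?N)"
    using int by (simp del: integral_map_pmf integrable_map_pmf_eq)
  also have "\<dots> = c + s * q + l * x"
    using expectation_posterior[OF P'(1) q] P'(2) by simp
  finally show ?thesis .
qed

lemma feasible_entropy_bounds:
  assumes P: "P \<in> feasible_laws \<delta> q x" and q: "0 \<le> q" "q < 1"
  shows "0 \<le> x" "x \<le> hb q"
proof -
  let ?N = "map_pmf W_rv P"
  have P': "P \<in> aux_laws \<delta> q" "x = (\<integral>w. hb (posterior P w) \<partial>?N)"
    using P by (auto simp: feasible_laws_def cond_entropy_X_W)
  have mean: "(\<integral>w. posterior P w \<partial>?N) = q" using P'(1) q by (intro expectation_posterior) auto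
  note int = integrable_posterior[of P]
  show "0 \<le> x" unfolding P'(2) by (intro Bochner_Integration.integral_nonneg hb_nonneg posterior_bounds)
  show "x \<le> hb q"
  proof (cases "q = 0")
    case True
    then have "AE w in ?N. posterior P w = 0"
      using mean integral_nonneg_eq_0_iff_AE[OF int(1)] posterior_bounds[of P] by auto
    then have "x = (\<integral>w. 0 \<partial>?N)"
      unfolding P'(2) by (intro integral_cong_AE) auto
    then show ?thesis using True by simp
  next
    case False
    have "x \<le> (\<integral>w. - posterior P w * log 2 q - (1 - posterior P w) * log 2 (1 - q) \<partial>?N)"
      unfolding P'(2)
      by (intro integral_mono int hb_le_cross_entropy posterior_bounds Bochner_Integration.integrable_diff integrable_mult_left
          Bochner_Integration.integrable_minus measure_pmf.integrable_const) (use False q in auto)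
    also have "\<dots> = hb q"
      using int(1) mean by (simp add: hb_def del: integral_map_pmf integrable_map_pmf_eq)
    finally show ?thesis .
  qed
qed

section \<open>Attainment and the range of the parametrisation\<close>

lemma posterior_aux_law:
  assumes "0 \<le> p w" "p w \<le> 1" "w \<in> set_pmf Q"
  shows "posterior (aux_law \<delta> Q p) w = p w"
  using assms by (simp add: posterior_def map_W_aux_law pmf_XW_aux_law set_pmf_iff)

lemma aux_law_entropies:
  fixes Q :: "nat pmf"
  assumes p: "\<And>w. 0 \<le> p w" "\<And>w. p w \<le> 1" and mean: "(\<integral>w. p w \<partial>Q) = q"
    and \<delta>: "0 \<le> \<delta>" "\<delta> \<le> 1"
  shows "cond_entropy (aux_law \<delta> Q p) X_rv W_rv = (\<integral>w. hb (p w) \<partial>Q)"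
    and "cond_entropy (aux_law \<delta> Q p) Y_rv W_rv = (\<integral>w. hb (\<delta> \<star> p w) \<partial>Q)"
  unfolding cond_entropy_X_W cond_entropy_Y_W[OF aux_law_in_aux_laws[OF p mean] \<delta>] map_W_aux_law
  by (auto intro!: integral_cong_AE simp: AE_measure_pmf_iff posterior_aux_law p)

lemma three_point_pmf:
  fixes \<alpha> \<beta> :: real
  assumes "0 \<le> \<alpha>" "0 \<le> \<beta>" "\<alpha> + \<beta> \<le> 1"
  obtains Q :: "nat pmf" where
    "\<And>f :: nat \<Rightarrow> real. (\<integral>w. f w \<partial>Q) = (1 - \<alpha> - \<beta>) * f 0 + \<alpha> * f 1 + \<beta> * f 2"
proof
  let ?xs = "[(0, 1 - \<alpha> - \<beta>), (Suc 0, \<alpha>), (2, \<beta>)]"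
  have wf: "pmf_of_list_wf ?xs" using assms by (simp add: pmf_of_list_wf_def)
  show "(\<integral>w. f w \<partial>pmf_of_list ?xs) = (1 - \<alpha> - \<beta>) * f 0 + \<alpha> * f 1 + \<beta> * f 2" for f :: "nat \<Rightarrow> real"
    using set_pmf_of_list[OF wf]
    by (subst integral_measure_pmf_real[where A="{0, 1, 2}"]) (auto simp: pmf_pmf_of_list[OF wf])
qed

lemma is_maximum_param:
  fixes \<delta> q \<alpha> :: real
  assumes \<delta>: "0 \<le> \<delta>" "\<delta> \<le> 1" and q: "0 \<le> q" "q \<le> 1 / 2" and \<alpha>: "0 \<le> \<alpha>" "\<alpha> \<le> 1"
  defines "r \<equiv> q / max \<alpha> (2 * q)"
  shows "is_maximum ((\<lambda>P. cond_entropy P Y_rv W_rv) ` feasible_laws \<delta> q (\<alpha> * hb r))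
    (\<alpha> * hb (\<delta> \<star> r) + (1 - \<alpha>) * hb \<delta>)"
proof -
  have r0: "0 \<le> r" using q \<alpha> by (simp add: r_def)
  have r_half: "r \<le> 1 / 2"
    using q \<alpha> by (cases "q = 0") (auto simp: r_def field_simps)
  \<comment> \<open>The two regimes of the maximum: for \<open>2 * q \<le> \<alpha>\<close> the
    posterior \<open>r\<close> alone accounts for the mean \<open>q\<close>, otherwise
    \<open>r\<close> stays at 1/2.\<close>
  have r_cases: "\<alpha> * r = q \<or> r = 1 / 2 \<and> \<alpha> < 2 * q"
    using q \<alpha> by (cases "q = 0"; cases "2 * q \<le> \<alpha>") (auto simp: r_def max_def)
  define \<beta> where "\<beta> = q - \<alpha> * r"
  have \<beta>: "0 \<le> \<beta>" "\<alpha> + \<beta> \<le> 1"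
  proof -
    have "\<alpha> * r = q \<or> \<alpha> * r = \<alpha> / 2 \<and> \<alpha> < 2 * q"
      using r_cases by (metis mult.commute mult_1 times_divide_eq_left)
    then have "\<alpha> * r \<le> q" "\<alpha> + (q - \<alpha> * r) \<le> 1" using q \<alpha> by linarith+
    then show "0 \<le> \<beta>" "\<alpha> + \<beta> \<le> 1" by (simp_all add: \<beta>_def)
  qed
  \<comment> \<open>W has the posteriors 0, r and 1; the last one is only needed when \<alpha> < 2 * q.\<close>
  obtain Q :: "nat pmf" where
    Q: "\<And>f :: nat \<Rightarrow> real. (\<integral>w. f w \<partial>Q) = (1 - \<alpha> - \<beta>) * f 0 + \<alpha> * f 1 + \<beta> * f 2"
    using three_point_pmf[OF \<alpha>(1) \<beta>] by blast
  define p where "p w = (if w = 1 then r else if w = 2 then 1 else 0)" for w :: nat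
  have p: "0 \<le> p w" "p w \<le> 1" for w using r0 r_half by (auto simp: p_def)
  have mean: "(\<integral>w. p w \<partial>Q) = q" by (simp add: Q p_def \<beta>_def)
  let ?P = "aux_law \<delta> Q p" and ?U = "\<alpha> * hb (\<delta> \<star> r) + (1 - \<alpha>) * hb \<delta>"
  have "cond_entropy ?P X_rv W_rv = \<alpha> * hb r"
    by (simp only: aux_law_entropies(1)[OF p mean \<delta>] Q) (simp add: p_def)
  then have "?P \<in> feasible_laws \<delta> q (\<alpha> * hb r)"
    by (simp add: feasible_laws_def aux_law_in_aux_laws[OF p mean])
  \<comment> \<open>The posteriors 0 and 1 have total mass \<open>1 - \<alpha>\<close>, and both
    give the output entropy \<open>hb \<delta>\<close>.\<close>
  moreover have "cond_entropy ?P Y_rv W_rv = ?U"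
    by (simp only: aux_law_entropies(2)[OF p mean \<delta>] Q)
      (simp add: p_def bconv_0 bconv_1 hb_symmetric algebra_simps)
  ultimately have attained: "?U \<in> (\<lambda>P. cond_entropy P Y_rv W_rv) ` feasible_laws \<delta> q (\<alpha> * hb r)"
    by (metis imageI)
  have "cond_entropy P Y_rv W_rv \<le> ?U" if P: "P \<in> feasible_laws \<delta> q (\<alpha> * hb r)" for P
  proof (cases "q = 0")
    case True
    \<comment> \<open>Here \<open>q\<close>, \<open>r\<close> and the entropy constraint are all 0,
      so any pair \<open>s\<close>, \<open>l\<close> will do; the point 1/2 is arbitrary.\<close>
    obtain s l where "\<And>p. 0 \<le> p \<Longrightarrow> p \<le> 1 \<Longrightarrow> hb (\<delta> \<star> p) \<le> hb \<delta> + s * p + l * hb p"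
      using hb_bconv_tangent[OF \<delta>, of "1 / 2"] by (metis half_gt_zero_iff order_refl zero_less_one)
    from cond_entropy_Y_W_le[OF P \<delta> _ _ this] q True show ?thesis
      by (simp add: r_def bconv_0 algebra_simps)
  next
    case False
    then have "0 < r" using q \<alpha> by (simp add: r_def)
    then obtain s l where
      tangent: "\<And>p. 0 \<le> p \<Longrightarrow> p \<le> 1 \<Longrightarrow> hb (\<delta> \<star> p) \<le> hb \<delta> + s * p + l * hb p" and
      eq: "hb (\<delta> \<star> r) = hb \<delta> + s * r + l * hb r" and s: "r = 1 / 2 \<Longrightarrow> s = 0"
      using hb_bconv_tangent[OF \<delta> _ r_half] by metis
    \<comment> \<open>Complementary slackness: when \<open>\<alpha> * r\<close> differs from
      \<open>q\<close>, \<open>r\<close> is 1/2 and \<open>s\<close> vanishes.\<close>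
    have "s * (\<alpha> * r) = s * q" using r_cases s by (metis mult_zero_left)
    moreover have "?U = hb \<delta> + s * (\<alpha> * r) + l * (\<alpha> * hb r)"
      unfolding eq by (simp add: algebra_simps)
    ultimately have "?U = hb \<delta> + s * q + l * (\<alpha> * hb r)" by (simp only:)
    with cond_entropy_Y_W_le[OF P \<delta> _ _ tangent] q show ?thesis by simp
  qed
  with attained show ?thesis by (auto simp: is_maximum_def)
qed

lemma U_T_eq:
  assumes "is_maximum ((\<lambda>P. cond_entropy P Y_rv W_rv) ` feasible_laws \<delta> q x) m"
  shows "U_T \<delta> q x = m"
  unfolding U_T_def using assms
  by (intro the_equality) (auto simp: is_maximum_def intro: order.antisym)

text \<open>The curve runs from 0 at \<open>\<alpha> = 0\<close> to \<open>hb q\<close> at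
  \<open>\<alpha> = 1\<close>. For \<open>q > 0\<close> the denominator is at least
  \<open>2 * q\<close>, which gives continuity; for \<open>q = 0\<close> only \<open>x = 0\<close>
  remains.\<close>

lemma param_surj:
  assumes q: "0 \<le> q" "q \<le> 1 / 2" and x: "0 \<le> x" "x \<le> hb q"
  shows "\<exists>\<alpha>\<in>{0..1}. x = \<alpha> * hb (q / max \<alpha> (2 * q))"
proof (cases "q = 0")
  case True
  then show ?thesis using x by (intro bexI[of _ 0]) auto
next
  case False
  have "continuous_on {0..1} (\<lambda>\<alpha>. \<alpha> * hb (q / max \<alpha> (2 * q)))"
    using q False
    by (intro continuous_intros continuous_on_compose2[OF continuous_on_hb])
      (auto simp: divide_le_eq_1 max_def)
  moreover have "max 1 (2 * q) = 1" using q by simp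
  ultimately have "\<exists>\<alpha>\<ge>0. \<alpha> \<le> 1 \<and> \<alpha> * hb (q / max \<alpha> (2 * q)) = x"
    using x by (intro IVT') simp_all
  then show ?thesis by auto
qed

text \<open>Since \<open>U_T\<close> is a definite description, \<open>is_maximum\<close> records
  that the maximum exists; the second conjunct shows that the curve misses no feasible
  \<open>x\<close>.\<close>

theorem theorem2:
  fixes \<delta> q :: real
  assumes "0 \<le> \<delta>" "\<delta> \<le> 1" and "0 \<le> q" "q \<le> 1 / 2"
  shows "(\<forall>\<alpha>\<in>{0..1}. let z = max \<alpha> (2 * q); x = \<alpha> * hb (q / z) in
            is_maximum ((\<lambda>P. cond_entropy P Y_rv W_rv) ` feasible_laws \<delta> q x) (U_T \<delta> q x) \<and>
            U_T \<delta> q x = \<alpha> * hb (\<delta> \<star> (q / z)) + (1 - \<alpha>) * hb \<delta>) \<and>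
         (\<forall>x. feasible_laws \<delta> q x \<noteq> {} \<longrightarrow>
            (\<exists>\<alpha>\<in>{0..1}. x = \<alpha> * hb (q / max \<alpha> (2 * q))))"
proof (intro conjI ballI allI impI)
  fix \<alpha> :: real assume "\<alpha> \<in> {0..1}"
  then show "let z = max \<alpha> (2 * q); x = \<alpha> * hb (q / z) in
      is_maximum ((\<lambda>P. cond_entropy P Y_rv W_rv) ` feasible_laws \<delta> q x) (U_T \<delta> q x) \<and>
      U_T \<delta> q x = \<alpha> * hb (\<delta> \<star> (q / z)) + (1 - \<alpha>) * hb \<delta>"
    using is_maximum_param[OF assms, of \<alpha>] U_T_eq by (simp add: Let_def)
next
  fix x assume "feasible_laws \<delta> q x \<noteq> {}"
  then obtain P where "P \<in> feasible_laws \<delta> q x" by blast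
  with assms show "\<exists>\<alpha>\<in>{0..1}. x = \<alpha> * hb (q / max \<alpha> (2 * q))"
    using feasible_entropy_bounds[of P \<delta> q x] by (intro param_surj) auto
qed

end
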